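(* Let $q,\alpha,z$ be complex numbers with $|q|<1$, $\alpha\ne0$, $z\neq 0$, and such that $-zq^{k}\neq\alpha$ for all integers $k\ge1$ and $-\alpha^2q^{2k+1}\neq z$ for all integers $k\ge 0$. Then $$\sum_{n=0}^{\infty}\frac{(-zq;q)_{2n}(-zq^{2n+2};q^2)_\infty}{(-zq/\alpha;q)_{n}}q^n=-\frac{\alpha}{z}\,\frac{(-zq;q)_{\infty}}{(-zq/\alpha;q)_{\infty}}\,\nu\!\left(\frac{\alpha^2}{z},-\frac{\alpha^2}{z};-q\right)+(-zq^2;q^2)_{\infty}\sum_{n=0}^{\infty}\frac{(-\alpha/z;q)_{n+1}\,\alpha^{n}q^{n(n+1)/2}}{(-\alpha^2q/z;q^2)_{n+1}}.$$
   Context: Notation: $(a;q)_n=\prod_{m=0}^{n-1}(1-aq^m)$, $(a;q)_0=1$, $(a;q)_\infty=\prod_{m=0}^{\infty}(1-aq^m)$ for $|q|<1$. Definition: $$\nu(\alpha,z;q)=\sum_{n=0}^{\infty}\frac{\alpha^{n}q^{n^{2}+n}}{(-zq;q^2)_{n+1}},$$ so that $\nu\left(\frac{\alpha^2}{z},-\frac{\alpha^2}{z};-q\right)=\sum_{n=0}^{\infty}\frac{(\alpha^2/z)^nq^{n^2+n}}{(-\alpha^2q/z;q^2)_{n+1}}$. *)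

theory Defs
  imports "HOL-Analysis.Analysis"
begin

definition qpoch :: "complex \<Rightarrow> complex \<Rightarrow> nat \<Rightarrow> complex" where
  "qpoch a q n = (\<Prod>m<n. 1 - a * q ^ m)"

(* Meaningful for norm q < 1 only. A vanishing factor is harmless: prodinf is then 0. *)
definition qpoch_inf :: "complex \<Rightarrow> complex \<Rightarrow> complex" where
  "qpoch_inf a q = prodinf (\<lambda>m. 1 - a * q ^ m)"

definition nu :: "complex \<Rightarrow> complex \<Rightarrow> complex \<Rightarrow> complex" where
  "nu \<alpha> z q = (\<Sum>n. \<alpha> ^ n * q ^ (n\<^sup>2 + n) / qpoch (- (z * q)) (q\<^sup>2) (n + 1))"

lemma nu_special:
  "nu (\<alpha>\<^sup>2 / z) (- (\<alpha>\<^sup>2 / z)) (- q) =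
    (\<Sum>n. (\<alpha>\<^sup>2 / z) ^ n * q ^ (n\<^sup>2 + n) / qpoch (- (\<alpha>\<^sup>2 * q / z)) (q\<^sup>2) (n + 1))"
  unfolding nu_def by (simp add: power_minus_even)

end

theory Submission
  imports Defs
begin

text \<open>
  Write \<open>p = \<alpha> / z\<close>. The common factor of the left-hand side is
  \<open>(-zq\<^sup>2;q\<^sup>2)\<^sub>\<infinity>\<close>; without it, the left-hand terms are
  \<open>s\<^sub>n = (-zq;q\<^sup>2)\<^sub>n q\<^sup>n / (-zq/\<alpha>;q)\<^sub>n\<close>. Both series on the right are values of one function,
  \<open>F(y) = \<Sum>n. (\<Prod>m\<le>n. y + p q\<^sup>m) \<alpha>\<^sup>n q^(n(n+1)/2) / (-\<alpha>pq;q\<^sup>2)\<^sub>n\<^sub>+\<^sub>1\<close>: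
  the last series is \<open>F(1)\<close>, and \<open>F(0)\<close> is \<open>p\<close> times the series \<open>\<nu>\<close>, because there the product
  degenerates to \<open>p^(n+1) q^(n(n+1)/2)\<close>.

  A telescoping sum gives the functional equation
  \<open>p (1 + z q y\<^sup>2) F(yq) = (p + yq) (F(y) - y)\<close> (lemma \<open>interp_functional_equation\<close>). At
  \<open>y = q\<^sup>k\<close> it says that \<open>s\<^sub>k\<close> is the difference of consecutive values of
  \<open>(-zq;q\<^sup>2)\<^sub>k / (-zq/\<alpha>;q)\<^sub>k * F(q\<^sup>k)\<close>, so the left-hand series telescopes too. Its sum is the
  initial value \<open>F(1)\<close> minus the limit, which is
  \<open>(-zq;q\<^sup>2)\<^sub>\<infinity> / (-zq/\<alpha>;q)\<^sub>\<infinity> * F(0)\<close> since \<open>F\<close> is continuous at \<open>0\<close> along \<open>q\<^sup>k\<close> by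
  Tannery's theorem (lemma \<open>interp_tendsto_0\<close>). The product \<open>(-zq;q)\<^sub>\<infinity>\<close> of the statement
  appears when the factor \<open>(-zq\<^sup>2;q\<^sup>2)\<^sub>\<infinity>\<close> is put back.
\<close>

section \<open>Finite and infinite q-Pochhammer symbols\<close>

lemma qpoch_0 [simp]: "qpoch a q 0 = 1"
  by (simp add: qpoch_def)

lemma qpoch_Suc: "qpoch a q (Suc n) = qpoch a q n * (1 - a * q ^ n)"
  by (simp add: qpoch_def)

lemma qpoch_add: "qpoch a q (n + m) = qpoch a q n * qpoch (a * q ^ n) q m"
  by (induction m) (simp_all add: qpoch_Suc power_add mult.assoc)

lemma qpoch_double: "qpoch a q (2 * n) = qpoch a (q\<^sup>2) n * qpoch (a * q) (q\<^sup>2) n"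
  by (induction n) (simp_all add: qpoch_Suc algebra_simps flip: power_mult)

lemma convergent_qpoch:
  fixes a q :: complex
  assumes "norm q < 1"
  shows "convergent_prod (\<lambda>m. 1 - a * q ^ m)"
proof -
  have "summable (\<lambda>m. norm a * norm q ^ m)"
    using assms by (intro summable_mult summable_geometric) auto
  then show ?thesis
    by (intro abs_convergent_prod_imp_convergent_prod summable_imp_abs_convergent_prod)
      (simp add: norm_mult norm_power)
qed

lemma qpoch_tendsto:
  assumes "norm q < 1"
  shows "(\<lambda>n. qpoch a q n) \<longlonglongrightarrow> qpoch_inf a q"
proof -
  have "(\<lambda>n. qpoch a q (Suc n)) \<longlonglongrightarrow> qpoch_inf a q"
    using convergent_prod_LIMSEQ[OF convergent_qpoch[OF assms]]
    by (simp add: qpoch_def qpoch_inf_def lessThan_Suc_atMost)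
  then show ?thesis
    by (rule LIMSEQ_imp_Suc)
qed

lemma qpoch_inf_nonzero:
  assumes "norm q < 1" "\<And>m. a * q ^ m \<noteq> 1"
  shows "qpoch_inf a q \<noteq> 0"
  unfolding qpoch_inf_def
  using assms by (intro prodinf_nonzero convergent_qpoch) auto

lemma norm_power2_less_1:
  fixes q :: complex
  shows "norm q < 1 \<Longrightarrow> norm (q\<^sup>2) < 1"
  by (simp add: norm_power power_less_one_iff)

lemma qpoch_inf_split:
  assumes "norm q < 1"
  shows "qpoch_inf a q = qpoch a q n * qpoch_inf (a * q ^ n) q"
proof (rule LIMSEQ_unique)
  show "(\<lambda>m. qpoch a q (m + n)) \<longlonglongrightarrow> qpoch_inf a q"
    using qpoch_tendsto[OF assms] by (rule LIMSEQ_ignore_initial_segment)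
  show "(\<lambda>m. qpoch a q (m + n)) \<longlonglongrightarrow> qpoch a q n * qpoch_inf (a * q ^ n) q"
    unfolding add.commute[of _ n] qpoch_add
    by (intro tendsto_intros qpoch_tendsto assms)
qed

lemma qpoch_inf_double:
  assumes "norm q < 1"
  shows "qpoch_inf a q = qpoch_inf a (q\<^sup>2) * qpoch_inf (a * q) (q\<^sup>2)"
proof (rule LIMSEQ_unique)
  have "strict_mono (\<lambda>n::nat. 2 * n)"
    by (simp add: strict_mono_def)
  then show "(\<lambda>n. qpoch a q (2 * n)) \<longlonglongrightarrow> qpoch_inf a q"
    using LIMSEQ_subseq_LIMSEQ[OF qpoch_tendsto[OF assms]] by (simp add: o_def)
  show "(\<lambda>n. qpoch a q (2 * n)) \<longlonglongrightarrow> qpoch_inf a (q\<^sup>2) * qpoch_inf (a * q) (q\<^sup>2)"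
    unfolding qpoch_double
    by (intro tendsto_intros qpoch_tendsto norm_power2_less_1 assms)
qed

text \<open>
  A convergent sequence of nonzero numbers with nonzero limit stays away from \<open>0\<close>; this makes the
  denominators of the series harmless in all estimates.
\<close>

lemma inverse_qpoch_bounded:
  assumes "norm q < 1" "\<And>m. a * q ^ m \<noteq> 1"
  obtains B where "\<And>n. norm (inverse (qpoch a q n)) \<le> B"
proof -
  have "(\<lambda>n. inverse (qpoch a q n)) \<longlonglongrightarrow> inverse (qpoch_inf a q)"
    by (intro tendsto_inverse qpoch_tendsto qpoch_inf_nonzero assms)
  then have "Bseq (\<lambda>n. inverse (qpoch a q n))"
    by (intro convergent_imp_Bseq convergentI)
  then show ?thesis
    using that by (auto simp: Bseq_def)
qed

section \<open>The interpolating series\<close>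

lemma triangle_Suc: "Suc n * (Suc n + 1) div 2 = n * (n + 1) div 2 + Suc n"
proof -
  have "Suc n * (Suc n + 1) = n * (n + 1) + 2 * Suc n"
    by (simp add: algebra_simps)
  then show ?thesis
    by (simp only: div_mult_self2[OF zero_neq_numeral[symmetric]])
qed

lemma double_triangle: "n * (n + 1) div 2 + n * (n + 1) div 2 = n\<^sup>2 + (n::nat)"
proof -
  have "2 * (n * (n + 1) div 2) = n * (n + 1)"
    by (rule dvd_mult_div_cancel) simp
  also have "\<dots> = n\<^sup>2 + n"
    by (simp add: power2_eq_square)
  finally show ?thesis
    by (simp only: mult_2)
qed

lemma prod_power_triangle:
  fixes p q :: complex
  shows "(\<Prod>m<Suc n. p * q ^ m) = p ^ Suc n * q ^ (n * (n + 1) div 2)"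
proof (induction n)
  case (Suc n)
  show ?case
    unfolding prod.lessThan_Suc[of _ "Suc n"] triangle_Suc Suc.IH
    by (simp only: power_add power_Suc mult_ac)
qed simp

text \<open>
  The length \<open>j\<close> of the products is separate from the exponent \<open>n\<close>: the terms of the series
  \<open>F\<close> have \<open>j = Suc n\<close>, while the telescoping sequence behind its functional equation has
  \<open>j = n\<close>, and one estimate covers both.
\<close>

definition interp_term :: "complex \<Rightarrow> complex \<Rightarrow> complex \<Rightarrow> complex \<Rightarrow> nat \<Rightarrow> nat \<Rightarrow> complex" where
  "interp_term p \<alpha> q y j n =
     (\<Prod>m<j. y + p * q ^ m) * \<alpha> ^ n * q ^ (n * (n + 1) div 2) / qpoch (- (\<alpha> * p * q)) (q\<^sup>2) j"

definition interp :: "complex \<Rightarrow> complex \<Rightarrow> complex \<Rightarrow> complex \<Rightarrow> complex" where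
  "interp p \<alpha> q y = (\<Sum>n. interp_term p \<alpha> q y (Suc n) n)"

lemma summable_power_triangle:
  fixes c r :: real
  assumes "0 \<le> r" "r < 1"
  shows "summable (\<lambda>n. c ^ n * r ^ (n * (n + 1) div 2))"
proof -
  have "(\<lambda>n. \<bar>c\<bar> * r ^ Suc n) \<longlonglongrightarrow> \<bar>c\<bar> * 0"
    using assms by (intro tendsto_mult tendsto_const LIMSEQ_Suc[OF LIMSEQ_realpow_zero])
  then have "\<forall>\<^sub>F n in sequentially. \<bar>c\<bar> * r ^ Suc n < 1 / 2"
    by (rule order_tendstoD(2)) simp
  then obtain N where N: "\<bar>c\<bar> * r ^ Suc n < 1 / 2" if "n \<ge> N" for n
    by (auto simp: eventually_sequentially)
  show ?thesis
  proof (rule summable_ratio_test)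
    show "norm (c ^ Suc n * r ^ (Suc n * (Suc n + 1) div 2))
        \<le> 1 / 2 * norm (c ^ n * r ^ (n * (n + 1) div 2))" if "n \<ge> N" for n
    proof -
      have "norm (c ^ Suc n * r ^ (Suc n * (Suc n + 1) div 2))
          = (\<bar>c\<bar> * r ^ Suc n) * norm (c ^ n * r ^ (n * (n + 1) div 2))"
        using assms unfolding triangle_Suc
        by (simp add: power_add abs_mult power_abs)
      also have "\<dots> \<le> 1 / 2 * norm (c ^ n * r ^ (n * (n + 1) div 2))"
        using N[OF that] by (intro mult_right_mono) auto
      finally show ?thesis .
    qed
  qed simp
qed

text \<open>
  The Gaussian decay of \<open>q^(n(n+1)/2)\<close> beats the geometric growth of everything else, uniformly for
  \<open>y\<close> in the unit disc. The uniformity is what Tannery's theorem needs.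
\<close>

lemma interp_term_dominated:
  assumes q: "norm q < 1" and nz: "\<And>k. \<alpha> * p * q ^ (2 * k + 1) \<noteq> -1"
  obtains M where "summable M"
    and "\<And>y j n. norm y \<le> 1 \<Longrightarrow> j \<le> Suc n \<Longrightarrow> norm (interp_term p \<alpha> q y j n) \<le> M n"
proof -
  have nz': "- (\<alpha> * p * q) * (q\<^sup>2) ^ m \<noteq> 1" for m
  proof -
    have "- (\<alpha> * p * q) * (q\<^sup>2) ^ m = - (\<alpha> * p * q ^ (2 * m + 1))"
      by (simp add: power_mult)
    then show ?thesis
      using nz[of m] by (metis add.inverse_inverse)
  qed
  from inverse_qpoch_bounded[OF norm_power2_less_1[OF q] nz']
  obtain B where B: "norm (inverse (qpoch (- (\<alpha> * p * q)) (q\<^sup>2) n)) \<le> B" for n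
    by blast
  define P where "P = 1 + norm p"
  define M where "M n = P * B * ((P * norm \<alpha>) ^ n * norm q ^ (n * (n + 1) div 2))" for n
  have "summable M"
    unfolding M_def using q by (intro summable_mult summable_power_triangle) auto
  moreover have "norm (interp_term p \<alpha> q y j n) \<le> M n" if y: "norm y \<le> 1" and j: "j \<le> Suc n" for y j n
  proof -
    have "norm (\<Prod>m<j. y + p * q ^ m) \<le> (\<Prod>m<j. P)"
      unfolding prod_norm[symmetric]
    proof (intro prod_mono conjI norm_ge_zero)
      fix m
      have "norm (y + p * q ^ m) \<le> norm y + norm p * norm q ^ m"
        by (metis norm_triangle_ineq norm_mult norm_power)
      also have "\<dots> \<le> 1 + norm p * 1"
        using y q by (intro add_mono mult_left_mono power_le_one) auto
      finally show "norm (y + p * q ^ m) \<le> P"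
        by (simp add: P_def)
    qed
    also have "\<dots> \<le> P ^ Suc n"
      using j by (simp only: prod_constant card_lessThan) (intro power_increasing, auto simp: P_def)
    finally have prod: "norm (\<Prod>m<j. y + p * q ^ m) \<le> P ^ Suc n" .
    have "norm (interp_term p \<alpha> q y j n)
        = norm (\<Prod>m<j. y + p * q ^ m) * (norm \<alpha> ^ n * norm q ^ (n * (n + 1) div 2))
          * norm (inverse (qpoch (- (\<alpha> * p * q)) (q\<^sup>2) j))"
      by (simp add: interp_term_def norm_mult norm_power norm_divide norm_inverse divide_inverse)
    also have "\<dots> \<le> P ^ Suc n * (norm \<alpha> ^ n * norm q ^ (n * (n + 1) div 2)) * B"
      by (intro mult_mono prod B order_refl mult_nonneg_nonneg zero_le_power norm_ge_zero)
        (simp_all add: P_def)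
    also have "\<dots> = M n"
      by (simp add: M_def power_mult_distrib)
    finally show ?thesis .
  qed
  ultimately show ?thesis
    using that by blast
qed

lemma interp_term_summable:
  assumes "norm q < 1" "\<And>k. \<alpha> * p * q ^ (2 * k + 1) \<noteq> -1" "norm y \<le> 1"
  shows "summable (\<lambda>n. interp_term p \<alpha> q y (Suc n) n)"
proof -
  obtain M where "summable M"
    and "\<And>y j n. norm y \<le> 1 \<Longrightarrow> j \<le> Suc n \<Longrightarrow> norm (interp_term p \<alpha> q y j n) \<le> M n"
    using interp_term_dominated[OF assms(1,2)] by blast
  with assms(3) show ?thesis
    by (auto intro: summable_comparison_test'[of M 0])
qed

lemma interp_tendsto_0:
  assumes q: "norm q < 1" and nz: "\<And>k. \<alpha> * p * q ^ (2 * k + 1) \<noteq> -1"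
  shows "(\<lambda>k. interp p \<alpha> q (q ^ k)) \<longlonglongrightarrow> interp p \<alpha> q 0"
proof -
  obtain M where M: "summable M"
    and bound: "\<And>y j n. norm y \<le> 1 \<Longrightarrow> j \<le> Suc n \<Longrightarrow> norm (interp_term p \<alpha> q y j n) \<le> M n"
    using interp_term_dominated[OF assms] by blast
  have "norm (q ^ k) \<le> 1" for k
    using q by (simp add: norm_power power_le_one)
  then have "norm (interp_term p \<alpha> q (q ^ k) (Suc n) n) \<le> M n" for n k
    by (intro bound) auto
  then have "\<forall>\<^sub>F (n, k) in sequentially \<times>\<^sub>F sequentially.
      norm (interp_term p \<alpha> q (q ^ k) (Suc n) n) \<le> M n"
    by (intro always_eventually) auto
  moreover have "(\<lambda>k. interp_term p \<alpha> q (q ^ k) (Suc n) n) \<longlonglongrightarrow> interp_term p \<alpha> q 0 (Suc n) n" for n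
    unfolding interp_term_def divide_inverse
    by (intro tendsto_mult tendsto_prod tendsto_add tendsto_const LIMSEQ_power_zero q)
  ultimately show ?thesis
    unfolding interp_def
    by (intro tannerys_theorem[THEN conjunct2, THEN conjunct2, OF _ _ M]) simp_all
qed

text \<open>
  The first factor of the product for \<open>yq\<close> is \<open>yq + p\<close>, and the others are \<open>q\<close> times factors of the
  product for \<open>y\<close>. So both sides share the product of length \<open>n\<close>, and \<open>\<alpha> = z p\<close> turns what remains
  into the difference of consecutive values of \<open>interp_term p \<alpha> q y n n\<close>.
\<close>

lemma interp_term_telescopes:
  assumes nz: "\<And>k. \<alpha> * p * q ^ (2 * k + 1) \<noteq> -1" and \<alpha>: "\<alpha> = z * p"
  shows "(p + y * q) * interp_term p \<alpha> q y (Suc n) n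
           - p * (1 + z * q * y\<^sup>2) * interp_term p \<alpha> q (y * q) (Suc n) n
         = (p + y * q) * y * (interp_term p \<alpha> q y n n - interp_term p \<alpha> q y (Suc n) (Suc n))"
proof -
  define D where "D = qpoch (- (\<alpha> * p * q)) (q\<^sup>2) n"
  define Y where "Y = (\<Prod>m<n. y + p * q ^ m)"
  define g where "g = \<alpha> ^ n * q ^ (n * (n + 1) div 2)"
  define x where "x = q ^ n"
  define d where "d = 1 + \<alpha> * p * q * x\<^sup>2"
  have "d \<noteq> 0"
    using nz[of n] by (auto simp: d_def x_def mult.assoc power_even_eq add_eq_0_iff)
  have D_Suc: "qpoch (- (\<alpha> * p * q)) (q\<^sup>2) (Suc n) = D * d"
    unfolding qpoch_Suc D_def d_def x_def power_mult[symmetric] mult.commute[of n 2] by simp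
  have Y_Suc: "(\<Prod>m<Suc n. y + p * q ^ m) = Y * (y + p * x)"
    by (simp add: Y_def x_def)
  have "(\<Prod>m<Suc n. y * q + p * q ^ m) = (y * q + p) * (\<Prod>m<n. q * (y + p * q ^ m))"
    by (simp add: prod.lessThan_Suc_shift algebra_simps del: prod.lessThan_Suc)
  then have Yq_Suc: "(\<Prod>m<Suc n. y * q + p * q ^ m) = (y * q + p) * (x * Y)"
    by (simp add: prod.distrib Y_def x_def)
  have g_Suc: "\<alpha> ^ Suc n * q ^ (Suc n * (Suc n + 1) div 2) = g * (\<alpha> * q * x)"
    unfolding triangle_Suc by (simp add: g_def x_def power_add)
  have term_n: "interp_term p \<alpha> q y n n = Y * g / (D * d) * d"
    using \<open>d \<noteq> 0\<close> by (simp add: interp_term_def Y_def g_def D_def mult.assoc)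
  have term_Suc: "interp_term p \<alpha> q y (Suc n) n = Y * g / (D * d) * (y + p * x)"
    unfolding interp_term_def D_Suc Y_Suc mult.assoc[of _ "\<alpha> ^ n"] g_def[symmetric] by simp
  have term_Suc_q: "interp_term p \<alpha> q (y * q) (Suc n) n = Y * g / (D * d) * ((p + y * q) * x)"
    unfolding interp_term_def D_Suc Yq_Suc mult.assoc[of _ "\<alpha> ^ n"] g_def[symmetric]
    by (simp add: mult_ac add.commute)
  have term_Suc_Suc:
    "interp_term p \<alpha> q y (Suc n) (Suc n) = Y * g / (D * d) * ((y + p * x) * (\<alpha> * q * x))"
    unfolding interp_term_def D_Suc Y_Suc mult.assoc[of _ "\<alpha> ^ Suc n"] g_Suc by simp
  have "(p + y * q) * (y + p * x) - p * (1 + z * q * y\<^sup>2) * ((p + y * q) * x)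
      = (p + y * q) * y * (d - (y + p * x) * (\<alpha> * q * x))"
    unfolding d_def \<alpha> by (simp add: algebra_simps power2_eq_square)
  moreover have "u * (K * A) - c * (K * B) = K * (u * A - c * B)"
    and "u * (K * A - K * B) = K * (u * (A - B))" for u c K A B :: complex
    by (simp_all add: right_diff_distrib mult.left_commute)
  ultimately show ?thesis
    unfolding term_n term_Suc term_Suc_q term_Suc_Suc by (simp only:)
qed

lemma interp_functional_equation:
  assumes q: "norm q < 1" and nz: "\<And>k. \<alpha> * p * q ^ (2 * k + 1) \<noteq> -1"
    and \<alpha>: "\<alpha> = z * p" and y: "norm y \<le> 1"
  shows "p * (1 + z * q * y\<^sup>2) * interp p \<alpha> q (y * q) = (p + y * q) * (interp p \<alpha> q y - y)"
proof -
  obtain M where M: "summable M"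
    and bound: "\<And>y j n. norm y \<le> 1 \<Longrightarrow> j \<le> Suc n \<Longrightarrow> norm (interp_term p \<alpha> q y j n) \<le> M n"
    using interp_term_dominated[OF q nz] by blast
  have "summable (\<lambda>n. interp_term p \<alpha> q y n n)"
    using bound[OF y] by (intro summable_comparison_test'[OF M, of 0]) auto
  then have "(\<lambda>n. interp_term p \<alpha> q y n n) \<longlonglongrightarrow> 0"
    by (rule summable_LIMSEQ_zero)
  then have "(\<lambda>n. interp_term p \<alpha> q y n n - interp_term p \<alpha> q y (Suc n) (Suc n)) sums
      (interp_term p \<alpha> q y 0 0 - 0)"
    by (rule telescope_sums')
  then have "(\<lambda>n. interp_term p \<alpha> q y n n - interp_term p \<alpha> q y (Suc n) (Suc n)) sums 1"
    by (simp add: interp_term_def)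
  then have "(\<lambda>n. (p + y * q) * y * (interp_term p \<alpha> q y n n - interp_term p \<alpha> q y (Suc n) (Suc n)))
      sums ((p + y * q) * y * 1)"
    by (rule sums_mult)
  moreover have "norm (y * q) \<le> 1"
    using y q by (simp add: norm_mult mult_le_one)
  then have "(\<lambda>n. (p + y * q) * interp_term p \<alpha> q y (Suc n) n
        - p * (1 + z * q * y\<^sup>2) * interp_term p \<alpha> q (y * q) (Suc n) n)
      sums ((p + y * q) * interp p \<alpha> q y - p * (1 + z * q * y\<^sup>2) * interp p \<alpha> q (y * q))"
    unfolding interp_def
    by (intro sums_diff sums_mult summable_sums interp_term_summable q nz y)
  ultimately have "(p + y * q) * interp p \<alpha> q y - p * (1 + z * q * y\<^sup>2) * interp p \<alpha> q (y * q)
      = (p + y * q) * y * 1"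
    unfolding interp_term_telescopes[OF nz \<alpha>] by (rule sums_unique2[symmetric])
  then show ?thesis
    by (simp add: algebra_simps)
qed

section \<open>Telescoping of the left-hand series\<close>

text \<open>
  The factors of \<open>(-zq/\<alpha>;q)\<^sub>k\<close> are \<open>(p + q\<^sup>m\<^sup>+\<^sup>1) / p\<close>, and \<open>1 + zq\<^sup>2\<^sup>k\<^sup>+\<^sup>1\<close> is the new factor of
  \<open>(-zq;q\<^sup>2)\<^sub>k\<^sub>+\<^sub>1\<close>. The functional equation at \<open>y = q\<^sup>k\<close> contains exactly these two ratios,
  so weighting \<open>F(q\<^sup>k)\<close> by the quotient of the two symbols turns it into a telescoping relation.
\<close>

lemma sums_qpoch_ratio:
  assumes q: "norm q < 1" and z: "z \<noteq> 0" and p: "p \<noteq> 0"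
    and nz: "\<And>k. \<alpha> * p * q ^ (2 * k + 1) \<noteq> -1" and \<alpha>: "\<alpha> = z * p"
    and nz_p: "\<And>k. p + q ^ Suc k \<noteq> 0"
  shows "(\<lambda>n. qpoch (- (z * q)) (q\<^sup>2) n / qpoch (- (z * q / \<alpha>)) q n * q ^ n) sums
    (interp p \<alpha> q 1
      - qpoch_inf (- (z * q)) (q\<^sup>2) / qpoch_inf (- (z * q / \<alpha>)) q * interp p \<alpha> q 0)"
proof -
  define b where "b = - (z * q / \<alpha>)"
  define R where "R k = qpoch (- (z * q)) (q\<^sup>2) k / qpoch b q k * interp p \<alpha> q (q ^ k)" for k
  have b: "1 - b * q ^ m = (p + q ^ Suc m) / p" for m
    using z p by (simp add: b_def \<alpha> field_simps)
  have b_nz: "b * q ^ m \<noteq> 1" for m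
    using b[of m] nz_p[of m] p by auto
  have step: "qpoch (- (z * q)) (q\<^sup>2) k / qpoch b q k * q ^ k = R k - R (Suc k)" for k
  proof -
    let ?A = "qpoch (- (z * q)) (q\<^sup>2) k" and ?B = "qpoch b q k"
    have "norm (q ^ k) \<le> 1"
      using q by (simp add: norm_power power_le_one)
    from interp_functional_equation[OF q nz \<alpha> this]
    have "p * (1 + z * q * (q ^ k)\<^sup>2) * interp p \<alpha> q (q ^ Suc k)
        = (p + q ^ Suc k) * (interp p \<alpha> q (q ^ k) - q ^ k)"
      by (simp add: mult.commute)
    then have "p * (1 + z * q * (q ^ k)\<^sup>2) * interp p \<alpha> q (q ^ Suc k) / (p + q ^ Suc k)
        = interp p \<alpha> q (q ^ k) - q ^ k"
      using nz_p[of k] by (simp only: nonzero_mult_div_cancel_left not_False_eq_True)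
    moreover have "R (Suc k)
        = ?A / ?B * (p * (1 + z * q * (q ^ k)\<^sup>2) * interp p \<alpha> q (q ^ Suc k) / (p + q ^ Suc k))"
      unfolding R_def qpoch_Suc b power_mult[symmetric] mult.commute[of k 2]
    by (simp add: mult_ac)
    ultimately have "R (Suc k) = ?A / ?B * (interp p \<alpha> q (q ^ k) - q ^ k)"
      by (simp only:)
    then show ?thesis
      by (simp add: R_def right_diff_distrib)
  qed
  have "R \<longlonglongrightarrow> qpoch_inf (- (z * q)) (q\<^sup>2) / qpoch_inf b q * interp p \<alpha> q 0"
    unfolding R_def
    by (intro tendsto_mult tendsto_divide qpoch_tendsto interp_tendsto_0 qpoch_inf_nonzero
        norm_power2_less_1 q nz b_nz)
  from telescope_sums'[OF this] show ?thesis
    unfolding step[symmetric] by (simp add: R_def b_def)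
qed

theorem theorem1p3:
  fixes q \<alpha> z :: complex
  assumes "norm q < 1" and "\<alpha> \<noteq> 0" and "z \<noteq> 0"
    and "\<forall>k::nat. k \<ge> 1 \<longrightarrow> - (z * q ^ k) \<noteq> \<alpha>"
    and "\<forall>k::nat. - (\<alpha>\<^sup>2 * q ^ (2 * k + 1)) \<noteq> z"
  shows
    "summable (\<lambda>n. qpoch (- (z * q)) q (2 * n) * qpoch_inf (- (z * q ^ (2 * n + 2))) (q\<^sup>2)
        / qpoch (- (z * q / \<alpha>)) q n * q ^ n) \<and>
     summable (\<lambda>n. (\<alpha>\<^sup>2 / z) ^ n * q ^ (n\<^sup>2 + n)
        / qpoch (- (\<alpha>\<^sup>2 * q / z)) (q\<^sup>2) (n + 1)) \<and>
     summable (\<lambda>n. qpoch (- (\<alpha> / z)) q (n + 1) * \<alpha> ^ n * q ^ (n * (n + 1) div 2)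
        / qpoch (- (\<alpha>\<^sup>2 * q / z)) (q\<^sup>2) (n + 1)) \<and>
     (\<Sum>n. qpoch (- (z * q)) q (2 * n) * qpoch_inf (- (z * q ^ (2 * n + 2))) (q\<^sup>2)
        / qpoch (- (z * q / \<alpha>)) q n * q ^ n)
     = - (\<alpha> / z) * (qpoch_inf (- (z * q)) q / qpoch_inf (- (z * q / \<alpha>)) q)
         * nu (\<alpha>\<^sup>2 / z) (- (\<alpha>\<^sup>2 / z)) (- q)
       + qpoch_inf (- (z * q\<^sup>2)) (q\<^sup>2)
         * (\<Sum>n. qpoch (- (\<alpha> / z)) q (n + 1) * \<alpha> ^ n * q ^ (n * (n + 1) div 2)
              / qpoch (- (\<alpha>\<^sup>2 * q / z)) (q\<^sup>2) (n + 1))"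
proof -
  define p where "p = \<alpha> / z"
  have p: "p \<noteq> 0" and \<alpha>: "\<alpha> = z * p"
    using assms(2,3) by (simp_all add: p_def)
  have nz: "\<alpha> * p * q ^ (2 * k + 1) \<noteq> -1" for k
  proof
    assume "\<alpha> * p * q ^ (2 * k + 1) = -1"
    then have "- (\<alpha>\<^sup>2 * q ^ (2 * k + 1)) = z"
      using assms(3) by (simp add: p_def field_simps power2_eq_square)
    with assms(5) show False
      by blast
  qed
  have nz_p: "p + q ^ Suc k \<noteq> 0" for k
  proof
    assume "p + q ^ Suc k = 0"
    then have "- (z * q ^ Suc k) = \<alpha>"
      unfolding \<alpha> by (metis add_eq_0_iff2 mult_minus_right)
    with assms(4) show False
      by auto
  qed
  let ?S = "\<lambda>n. qpoch (- (z * q)) q (2 * n) * qpoch_inf (- (z * q ^ (2 * n + 2))) (q\<^sup>2)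
    / qpoch (- (z * q / \<alpha>)) q n * q ^ n"
  let ?N = "\<lambda>n. (\<alpha>\<^sup>2 / z) ^ n * q ^ (n\<^sup>2 + n) / qpoch (- (\<alpha>\<^sup>2 * q / z)) (q\<^sup>2) (n + 1)"
  let ?T = "\<lambda>n. qpoch (- (\<alpha> / z)) q (n + 1) * \<alpha> ^ n * q ^ (n * (n + 1) div 2)
    / qpoch (- (\<alpha>\<^sup>2 * q / z)) (q\<^sup>2) (n + 1)"
  let ?C = "qpoch_inf (- (z * q\<^sup>2)) (q\<^sup>2)"
  have \<alpha>p: "\<alpha>\<^sup>2 / z = \<alpha> * p" "\<alpha>\<^sup>2 * q / z = \<alpha> * p * q"
    by (simp_all add: p_def power2_eq_square)
  have T: "?T n = interp_term p \<alpha> q 1 (Suc n) n" for n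
    unfolding interp_term_def \<alpha>p p_def[symmetric] by (simp add: qpoch_def)
  have N: "p * ?N n = interp_term p \<alpha> q 0 (Suc n) n" for n
    unfolding interp_term_def \<alpha>p double_triangle[symmetric] add_0_left prod_power_triangle
    by (simp add: power_add power_mult_distrib mult_ac)
  have summable_T: "summable ?T"
    unfolding T by (intro interp_term_summable assms(1) nz) simp
  have "summable (\<lambda>n. p * ?N n)"
    unfolding N by (intro interp_term_summable assms(1) nz) simp
  then have summable_N: "summable ?N"
    using p by (simp only: summable_cmult_iff simp_thms)
  have interp_1: "interp p \<alpha> q 1 = suminf ?T"
    by (simp only: interp_def T)
  have interp_0: "interp p \<alpha> q 0 = p * nu (\<alpha>\<^sup>2 / z) (- (\<alpha>\<^sup>2 / z)) (- q)"
    unfolding nu_special interp_def N[symmetric] by (rule suminf_mult[OF summable_N])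
  have S: "?S n = ?C * (qpoch (- (z * q)) (q\<^sup>2) n / qpoch (- (z * q / \<alpha>)) q n * q ^ n)" for n
  proof -
    have shift: "- (z * q\<^sup>2) * (q\<^sup>2) ^ n = - (z * q ^ (2 * n + 2))"
      unfolding power_add power_mult by (simp only: minus_mult_left mult_ac)
    have "?C = qpoch (- (z * q\<^sup>2)) (q\<^sup>2) n * qpoch_inf (- (z * q ^ (2 * n + 2))) (q\<^sup>2)"
      using qpoch_inf_split[OF norm_power2_less_1[OF assms(1)], of "- (z * q\<^sup>2)" n]
      unfolding shift .
    moreover have "qpoch (- (z * q)) q (2 * n)
        = qpoch (- (z * q)) (q\<^sup>2) n * qpoch (- (z * q\<^sup>2)) (q\<^sup>2) n"
      unfolding qpoch_double by (simp add: power2_eq_square mult.assoc)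
    ultimately show ?thesis
      by simp
  qed
  have C: "qpoch_inf (- (z * q)) q = qpoch_inf (- (z * q)) (q\<^sup>2) * ?C"
    using qpoch_inf_double[OF assms(1), of "- (z * q)"] by (simp add: power2_eq_square mult.assoc)
  have sums_S: "?S sums (?C * (suminf ?T
      - qpoch_inf (- (z * q)) (q\<^sup>2) / qpoch_inf (- (z * q / \<alpha>)) q
        * (p * nu (\<alpha>\<^sup>2 / z) (- (\<alpha>\<^sup>2 / z)) (- q))))"
    unfolding S interp_1[symmetric] interp_0[symmetric]
    by (intro sums_mult sums_qpoch_ratio assms(1,3) p nz \<alpha> nz_p)
  have "suminf ?S = - (\<alpha> / z) * (qpoch_inf (- (z * q)) q / qpoch_inf (- (z * q / \<alpha>)) q)
      * nu (\<alpha>\<^sup>2 / z) (- (\<alpha>\<^sup>2 / z)) (- q) + ?C * suminf ?T"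
    unfolding sums_unique[OF sums_S, symmetric] C p_def[symmetric]
    by (simp add: right_diff_distrib mult_ac)
  then show ?thesis
    using sums_summable[OF sums_S] summable_N summable_T by blast
qed

end
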